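(* Let $\Omega\subset X$ be a $\nu$-measurable set with $0<\nu(\Omega)<\nu(X)$, and let $\lambda(\Omega)=\inf\{\lambda>0:\chi_\Omega\in M(\chi_\Omega,\lambda)\}$. Then $$\lambda(\Omega)=\sup\left\{\frac{P_m(\Omega)-P_m(E)}{\nu(\Omega\bigtriangleup E)}\ :\ E\subset X\ \nu\text{-measurable},\ \nu(\Omega\bigtriangleup E)>0\right\}.$$
   Context: Setting: $(X,d)$ is a Polish metric space with its Borel $\sigma$-algebra. A random walk $m=(m_x)_{x\in X}$ on $X$ is a family of Borel probability measures on $X$ such that $x\mapsto m_x(A)$ is Borel for every Borel $A\subset X$ and $\int_X d(z,y)\,dm_x(y)<\infty$ for all $x\in X$ and some (hence any) $z\in X$; $[X,d,m]$ is a metric random walk space. $\nu$ is a finite (nonzero) Radon measure on $X$ which is reversible for $m$: $dm_x(y)d\nu(x)=dm_y(x)d\nu(y)$ as measures on $X\times X$ (this implies invariance, $\nu(A)=\int_X m_x(A)\,d\nu(x)$). It is also assumed that $\frac1{\nu(X)}\nu$ is ergodic with respect to $m$: every Borel set $B$ with $m_x(B)=1$ for all $x\in B$ satisfies $\nu(B)=0$ or $\nu(B)=\nu(X)$. $m$-total variation: $TV_m(u)=\frac12\int_X\int_X|u(y)-u(x)|\,dm_x(y)\,d\nu(x)$. $m$-perimeter: $P_m(E)=\int_E\int_{X\setminus E}dm_x(y)\,d\nu(x)$. $A\bigtriangleup B=(A\setminus B)\cup(B\setminus A)$. $\mathcal E_m(u,f,\lambda)=TV_m(u)+\lambda\int_X|u-f|\,d\nu$,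 and $M(f,\lambda)$ is the set of $u\in L^1(X,\nu)$ minimizing $\mathcal E_m(\cdot,f,\lambda)$ over $L^1(X,\nu)$. The set $\{\lambda>0:\chi_\Omega\in M(\chi_\Omega,\lambda)\}$ is nonempty and the infimum defining the thresholding parameter $\lambda(\Omega)$ is attained. *)

theory Defs
  imports "HOL-Probability.Probability"
begin

definition random_walk :: "('a::polish_space \<Rightarrow> 'a measure) \<Rightarrow> bool" where
  "random_walk m \<longleftrightarrow>
     (\<forall>x. prob_space (m x) \<and> sets (m x) = sets borel) \<and>
     (\<forall>A\<in>sets borel. (\<lambda>x. emeasure (m x) A) \<in> borel_measurable borel) \<and>
     (\<exists>z. \<forall>x. (\<integral>\<^sup>+y. ennreal (dist z y) \<partial>m x) < \<infinity>)"

definition finite_radon_measure :: "'a::polish_space measure \<Rightarrow> bool" where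
  "finite_radon_measure \<nu> \<longleftrightarrow>
     sets \<nu> = sets borel \<and> finite_measure \<nu> \<and>
     (\<forall>B\<in>sets borel. emeasure \<nu> B = (SUP K\<in>{K. compact K \<and> K \<subseteq> B}. emeasure \<nu> K))"

text \<open>Both sides are values on \<open>C\<close>: of \<open>dm\<^sub>x(y) d\<nu>(x)\<close> on the left, of \<open>dm\<^sub>y(x) d\<nu>(y)\<close> on the right.\<close>

definition reversible :: "('a::polish_space \<Rightarrow> 'a measure) \<Rightarrow> 'a measure \<Rightarrow> bool" where
  "reversible m \<nu> \<longleftrightarrow>
     (\<forall>C\<in>sets (borel \<Otimes>\<^sub>M borel).
        (\<integral>\<^sup>+x. emeasure (m x) {y. (x, y) \<in> C} \<partial>\<nu>) =
        (\<integral>\<^sup>+y. emeasure (m y) {x. (x, y) \<in> C} \<partial>\<nu>))"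

definition ergodic :: "('a::polish_space \<Rightarrow> 'a measure) \<Rightarrow> 'a measure \<Rightarrow> bool" where
  "ergodic m \<nu> \<longleftrightarrow>
     (\<forall>B\<in>sets borel. (\<forall>x\<in>B. emeasure (m x) B = 1) \<longrightarrow>
        emeasure \<nu> B = 0 \<or> emeasure \<nu> B = emeasure \<nu> UNIV)"

text \<open>
  A \<open>\<nu>\<close>-measurable set is an element of \<open>sets (completion \<nu>)\<close>, and \<open>L\<^sup>1(X, \<nu>)\<close> is represented by the
  functions that are integrable with respect to \<open>completion \<nu>\<close>. Such sets and functions need not be
  Borel, and \<^const>\<open>emeasure\<close> is 0 outside the \<open>\<sigma>\<close>-algebra, so the inner integrals use the completions
  of the \<open>m x\<close>. If \<open>\<nu>\<close> is invariant, a \<open>\<nu>\<close>-null set is \<open>m x\<close>-null for \<open>\<nu>\<close>-almost every \<open>x\<close>; hence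
  the inner integrands are measurable for almost every \<open>x\<close>, and the functionals below do not change
  when a function or set is modified on a \<open>\<nu>\<close>-null set.
\<close>

definition TV :: "('a::polish_space \<Rightarrow> 'a measure) \<Rightarrow> 'a measure \<Rightarrow> ('a \<Rightarrow> real) \<Rightarrow> ennreal" where
  "TV m \<nu> u =
     (\<integral>\<^sup>+x. (\<integral>\<^sup>+y. ennreal \<bar>u y - u x\<bar> \<partial>completion (m x)) \<partial>completion \<nu>) / 2"

definition perimeter :: "('a::polish_space \<Rightarrow> 'a measure) \<Rightarrow> 'a measure \<Rightarrow> 'a set \<Rightarrow> ennreal" where
  "perimeter m \<nu> E =
     (\<integral>\<^sup>+x\<in>E. emeasure (completion (m x)) (UNIV - E) \<partial>completion \<nu>)"

definition energy ::
  "('a::polish_space \<Rightarrow> 'a measure) \<Rightarrow> 'a measure \<Rightarrow> ('a \<Rightarrow> real) \<Rightarrow> real \<Rightarrow> ('a \<Rightarrow> real) \<Rightarrow> ennreal" where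
  "energy m \<nu> f lam u =
     TV m \<nu> u + ennreal lam * (\<integral>\<^sup>+x. ennreal \<bar>u x - f x\<bar> \<partial>completion \<nu>)"

definition minimizers ::
  "('a::polish_space \<Rightarrow> 'a measure) \<Rightarrow> 'a measure \<Rightarrow> ('a \<Rightarrow> real) \<Rightarrow> real \<Rightarrow> ('a \<Rightarrow> real) set" where
  "minimizers m \<nu> f lam =
     {u. integrable (completion \<nu>) u \<and>
         (\<forall>v. integrable (completion \<nu>) v \<longrightarrow> energy m \<nu> f lam u \<le> energy m \<nu> f lam v)}"

definition threshold :: "('a::polish_space \<Rightarrow> 'a measure) \<Rightarrow> 'a measure \<Rightarrow> 'a set \<Rightarrow> real" where
  "threshold m \<nu> \<Omega> = Inf {lam. 0 < lam \<and> indicator \<Omega> \<in> minimizers m \<nu> (indicator \<Omega>) lam}"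

end

theory Submission imports Defs begin

text \<open>
  A minimizer of the energy with an indicator function as datum can be tested on indicator functions
  alone. For real \<open>v\<close>, both \<open>TV\<close> and the \<open>L\<^sup>1\<close> distance to \<open>\<chi>\<^sub>\<Omega>\<close> dominate the integral over
  the levels \<open>t\<close> in \<open>(0, 1)\<close> of the same quantity for \<open>E\<^sub>t = {v > t}\<close>: for the first this is the
  coarea inequality, and in the second \<open>\<chi>\<^sub>\<Omega>\<close> is its own superlevel indicator at each such level.
  The energy of \<open>v\<close> is therefore at least the average over these \<open>t\<close> of
  \<open>P(E\<^sub>t) + \<lambda> \<nu>(\<Omega> \<triangle> E\<^sub>t)\<close>, so \<open>\<chi>\<^sub>\<Omega>\<close> is a minimizer if and only if
  \<open>P(\<Omega>) \<le> P(E) + \<lambda> \<nu>(\<Omega> \<triangle> E)\<close> for all measurable \<open>E\<close> (lemma \<open>indicator_minimizer_iff\<close>).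

  If \<open>\<nu>(\<Omega> \<triangle> E) = 0\<close>, the perimeters agree and the condition holds; otherwise it says that
  the ratio belonging to \<open>E\<close> is at most \<open>\<lambda>\<close>. Hence the admissible \<open>\<lambda>\<close> are exactly the positive upper bounds
  of the ratios. Their infimum is the supremum of the ratios as soon as this is finite and nonnegative.
  Finiteness holds because perimeters of two sets differ by at most the measure of the symmetric
  difference (lemma \<open>perimeter_le_add_sym_diff\<close>), so no ratio exceeds 1; and the ratio of the whole
  space is nonnegative because its perimeter is 0.

  Total variation and perimeter are both given by one finite measure \<open>jump\<close> on the square of the
  space, the law of the pair (start, end) of one step started from \<open>\<nu>\<close>. By reversibility it gives
  equal mass to \<open>A \<times> B\<close> and \<open>B \<times> A\<close>, so both marginals are \<open>\<nu>\<close>. Hence changes on \<open>\<nu>\<close>-null sets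
  affect neither functional, and one may compute with Borel representatives.
\<close>

section \<open>Integrated distance of superlevel sets\<close>

lemma nn_integral_levels_between_le:
  fixes a b :: real
  shows "(\<integral>\<^sup>+t\<in>{0<..<1}. ennreal \<bar>indicator {t<..} a - indicator {t<..} b\<bar> \<partial>lborel) \<le> ennreal \<bar>a - b\<bar>"
proof -
  have "(\<integral>\<^sup>+t\<in>{0<..<1}. ennreal \<bar>indicator {t<..} a - indicator {t<..} b\<bar> \<partial>lborel)
      \<le> (\<integral>\<^sup>+t. indicator {min a b..max a b} t \<partial>lborel)"
    by (intro nn_integral_mono) (auto simp: indicator_def)
  also have "\<dots> = ennreal (max a b - min a b)"
    by (simp add: emeasure_lborel_Icc)
  also have "max a b - min a b = \<bar>a - b\<bar>"
    by auto
  finally show ?thesis .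
qed

lemma (in sigma_finite_measure) borel_measurable_superlevel_distance:
  fixes f g :: "'a \<Rightarrow> real"
  assumes [measurable]: "f \<in> borel_measurable M" "g \<in> borel_measurable M"
  shows "(\<lambda>t. \<integral>\<^sup>+x. ennreal \<bar>indicator {t<..} (f x) - indicator {t<..} (g x)\<bar> \<partial>M) \<in> borel_measurable lborel"
  unfolding indicator_def greaterThan_def by measurable

text \<open>
  Tonelli reduces this to the pointwise bound \<open>nn_integral_levels_between_le\<close>. With the law of a jump
  as measure, \<open>f\<close> the value at its end and \<open>g\<close> the value at its start, this is the coarea inequality;
  with \<open>\<nu>\<close> as measure and an indicator function as \<open>g\<close> it treats the fidelity term.
\<close>

lemma (in sigma_finite_measure) nn_integral_superlevel_distance_le:
  fixes f g :: "'a \<Rightarrow> real"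
  assumes [measurable]: "f \<in> borel_measurable M" "g \<in> borel_measurable M"
  shows "(\<integral>\<^sup>+t\<in>{0<..<1}. (\<integral>\<^sup>+x. ennreal \<bar>indicator {t<..} (f x) - indicator {t<..} (g x)\<bar> \<partial>M) \<partial>lborel)
     \<le> (\<integral>\<^sup>+x. ennreal \<bar>f x - g x\<bar> \<partial>M)"
proof -
  interpret pair_sigma_finite M lborel ..
  let ?h = "\<lambda>x t. ennreal \<bar>indicator {t<..} (f x) - indicator {t<..} (g x)\<bar> * indicator {0<..<1::real} t"
  have [measurable]: "(\<lambda>(x, t). ?h x t) \<in> borel_measurable (M \<Otimes>\<^sub>M lborel)"
    unfolding indicator_def greaterThan_def greaterThanLessThan_def lessThan_def by measurable
  have meas: "(\<lambda>x. ennreal \<bar>indicator {t<..} (f x) - indicator {t<..} (g x)\<bar>) \<in> borel_measurable M" for t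
    by measurable
  have "(\<integral>\<^sup>+t\<in>{0<..<1}. (\<integral>\<^sup>+x. ennreal \<bar>indicator {t<..} (f x) - indicator {t<..} (g x)\<bar> \<partial>M) \<partial>lborel)
      = (\<integral>\<^sup>+t. (\<integral>\<^sup>+x. ?h x t \<partial>M) \<partial>lborel)"
    by (simp add: nn_integral_multc meas)
  also have "\<dots> = (\<integral>\<^sup>+x. (\<integral>\<^sup>+t. ?h x t \<partial>lborel) \<partial>M)"
    by (rule Fubini') simp
  also have "\<dots> \<le> (\<integral>\<^sup>+x. ennreal \<bar>f x - g x\<bar> \<partial>M)"
    by (intro nn_integral_mono nn_integral_levels_between_le)
  finally show ?thesis .
qed

lemma nn_integral_indicator_diff:
  assumes "A \<in> sets M" "B \<in> sets M"
  shows "(\<integral>\<^sup>+x. ennreal \<bar>indicator A x - indicator B x\<bar> \<partial>M) = emeasure M (sym_diff B A)"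
proof -
  have "(\<integral>\<^sup>+x. ennreal \<bar>indicator A x - indicator B x\<bar> \<partial>M) = (\<integral>\<^sup>+x. indicator (sym_diff B A) x \<partial>M)"
    by (intro nn_integral_cong) (auto simp: indicator_def)
  with assms show ?thesis by simp
qed

section \<open>The law of a jump\<close>

locale reversible_walk =
  fixes m :: "'a::polish_space \<Rightarrow> 'a measure" and \<nu> :: "'a measure"
  assumes walk: "random_walk m"
    and radon: "finite_radon_measure \<nu>"
    and reversible: "reversible m \<nu>"
begin

lemma sets_invariant [measurable_cong, simp]: "sets \<nu> = sets borel"
  using radon by (simp add: finite_radon_measure_def)

lemma space_invariant [simp]: "space \<nu> = UNIV"
  using sets_eq_imp_space_eq[OF sets_invariant] by simp

sublocale finite_measure \<nu>
  using radon by (simp add: finite_radon_measure_def)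

lemma sets_walk [measurable_cong, simp]: "sets (m x) = sets borel"
  using walk by (simp add: random_walk_def)

lemma space_walk [simp]: "space (m x) = UNIV"
  using sets_eq_imp_space_eq[OF sets_walk] by simp

lemma emeasure_walk_UNIV [simp]: "emeasure (m x) UNIV = 1"
  using walk prob_space.emeasure_space_1[of "m x"] by (simp add: random_walk_def)

lemma walk_measurable [measurable]: "m \<in> borel \<rightarrow>\<^sub>M subprob_algebra borel"
  using walk by (intro measurable_subprob_algebra) (auto simp: random_walk_def prob_space_imp_subprob_space)

definition jump :: "('a \<times> 'a) measure" where
  "jump = \<nu> \<bind> (\<lambda>x. distr (m x) (borel \<Otimes>\<^sub>M borel) (Pair x))"

lemma jump_kernel_measurable:
  "(\<lambda>x. distr (m x) (borel \<Otimes>\<^sub>M borel) (Pair x)) \<in> \<nu> \<rightarrow>\<^sub>M subprob_algebra (borel \<Otimes>\<^sub>M borel)"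
  by (rule measurable_distr2[where M = borel]) measurable

lemma sets_jump [measurable_cong, simp]: "sets jump = sets (borel \<Otimes>\<^sub>M borel)"
  unfolding jump_def
  by (rule sets_bind) auto

lemma nn_integral_jump:
  assumes [measurable]: "f \<in> borel_measurable (borel \<Otimes>\<^sub>M borel)"
  shows "(\<integral>\<^sup>+p. f p \<partial>jump) = (\<integral>\<^sup>+x. \<integral>\<^sup>+y. f (x, y) \<partial>m x \<partial>\<nu>)"
  unfolding jump_def
  by (subst nn_integral_bind[OF assms jump_kernel_measurable]) (simp add: nn_integral_distr)

lemma emeasure_jump_Times:
  assumes [measurable]: "A \<in> sets borel" "B \<in> sets borel"
  shows "emeasure jump (A \<times> B) = (\<integral>\<^sup>+x\<in>A. emeasure (m x) B \<partial>\<nu>)"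
proof -
  have "emeasure jump (A \<times> B) = (\<integral>\<^sup>+p. indicator (A \<times> B) p \<partial>jump)"
    by (simp add: pair_measureI)
  also have "\<dots> = (\<integral>\<^sup>+x. \<integral>\<^sup>+y. indicator A x * indicator B y \<partial>m x \<partial>\<nu>)"
    by (subst nn_integral_jump) (auto simp: indicator_times intro!: borel_measurable_indicator pair_measureI)
  also have "\<dots> = (\<integral>\<^sup>+x\<in>A. emeasure (m x) B \<partial>\<nu>)"
    by (simp add: nn_integral_cmult mult.commute)
  finally show ?thesis .
qed

lemma emeasure_jump_Times_UNIV [simp]:
  "A \<in> sets borel \<Longrightarrow> emeasure jump (A \<times> UNIV) = emeasure \<nu> A"
  by (simp add: emeasure_jump_Times)

lemma emeasure_jump_swap:
  assumes [measurable]: "A \<in> sets borel" "B \<in> sets borel"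
  shows "emeasure jump (A \<times> B) = emeasure jump (B \<times> A)"
proof -
  have "(\<integral>\<^sup>+x. emeasure (m x) {y. (x, y) \<in> A \<times> B} \<partial>\<nu>) = (\<integral>\<^sup>+y. emeasure (m y) {x. (x, y) \<in> A \<times> B} \<partial>\<nu>)"
    using reversible pair_measureI[OF assms] unfolding reversible_def by blast
  moreover have "(\<integral>\<^sup>+x. emeasure (m x) {y. (x, y) \<in> A \<times> B} \<partial>\<nu>) = emeasure jump (A \<times> B)"
    by (subst emeasure_jump_Times) (auto intro!: nn_integral_cong simp: indicator_def)
  moreover have "(\<integral>\<^sup>+y. emeasure (m y) {x. (x, y) \<in> A \<times> B} \<partial>\<nu>) = emeasure jump (B \<times> A)"
    by (subst emeasure_jump_Times) (auto intro!: nn_integral_cong simp: indicator_def)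
  ultimately show ?thesis by simp
qed

lemma emeasure_jump_UNIV_Times [simp]:
  "A \<in> sets borel \<Longrightarrow> emeasure jump (UNIV \<times> A) = emeasure \<nu> A"
  using emeasure_jump_swap[of UNIV A] by simp

sublocale jump: finite_measure jump
proof
  have "space jump = UNIV \<times> UNIV"
    using sets_eq_imp_space_eq[OF sets_jump] by (simp add: space_pair_measure)
  then show "emeasure jump (space jump) \<noteq> \<infinity>"
    using emeasure_finite[of UNIV] emeasure_jump_Times_UNIV[of UNIV] by simp
qed

text \<open>
  The second marginal of \<open>jump\<close> is \<open>\<nu>\<close>, so the measure that \<open>m x\<close> gives to a \<open>\<nu>\<close>-null set has
  integral 0 over \<open>x\<close>. The property \<open>P\<close> may be non-measurable, as needed for completions.
\<close>

lemma AE_walk: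
  assumes "AE x in \<nu>. P x"
  shows "AE x in \<nu>. AE y in m x. P y"
proof -
  obtain N where N: "{x. \<not> P x} \<subseteq> N" "emeasure \<nu> N = 0" "N \<in> sets borel"
    using assms by (auto elim!: AE_E)
  then have [measurable]: "N \<in> sets borel" by simp
  have "(\<integral>\<^sup>+x. emeasure (m x) N \<partial>\<nu>) = 0"
    using N emeasure_jump_Times[of UNIV N] by simp
  then have "AE x in \<nu>. emeasure (m x) N = 0"
    by (subst (asm) nn_integral_0_iff_AE) auto
  then show ?thesis
  proof eventually_elim
    case (elim x)
    with N show ?case by (intro AE_I[of _ _ N]) auto
  qed
qed

section \<open>Total variation and perimeter on Borel representatives\<close>

lemma TV_cong_AE:
  assumes ae: "AE x in \<nu>. u x = v x"
  shows "TV m \<nu> u = TV m \<nu> v"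
proof -
  have "AE x in \<nu>. (\<integral>\<^sup>+y. ennreal \<bar>u y - u x\<bar> \<partial>m x) = (\<integral>\<^sup>+y. ennreal \<bar>v y - v x\<bar> \<partial>m x)"
    using AE_walk[OF ae] ae
    by eventually_elim (auto intro!: nn_integral_cong_AE)
  then show ?thesis
    unfolding TV_def nn_integral_completion by (simp cong: nn_integral_cong_AE)
qed

lemma TV_Borel:
  assumes [measurable]: "u \<in> borel_measurable borel"
  shows "TV m \<nu> u = (\<integral>\<^sup>+p. ennreal \<bar>u (snd p) - u (fst p)\<bar> \<partial>jump) / 2"
  unfolding TV_def nn_integral_completion by (subst nn_integral_jump) auto

lemma Borel_set_representative:
  assumes "E \<in> sets (completion \<nu>)"
  obtains E' where "E' \<in> sets borel" "AE x in \<nu>. x \<in> E \<longleftrightarrow> x \<in> E'"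
  using AE_in_main_part[OF assms] main_part_sets[OF assms] sets_invariant by (metis (mono_tags, lifting) AE_mp AE_I2)

text \<open>
  For \<open>\<nu>\<close>-almost every \<open>x\<close> the sets \<open>E\<close> and \<open>E'\<close> agree \<open>m x\<close>-almost everywhere, which also makes
  \<open>E\<close> measurable for the completion of \<open>m x\<close>. This must be shown, since otherwise the inner
  measure would take its default value 0.
\<close>

lemma perimeter_Borel_representative:
  assumes [measurable]: "E' \<in> sets borel" and ae: "AE x in \<nu>. x \<in> E \<longleftrightarrow> x \<in> E'"
  shows "perimeter m \<nu> E = emeasure jump (E' \<times> (UNIV - E'))"
proof -
  have "AE x in \<nu>. emeasure (completion (m x)) (UNIV - E) * indicator E x
      = emeasure (m x) (UNIV - E') * indicator E' x"
    using AE_walk[OF ae] ae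
  proof eventually_elim
    case (elim x)
    have ae': "AE y in completion (m x). y \<in> UNIV - E' \<longleftrightarrow> y \<in> UNIV - E"
      using elim(1) by (auto simp: AE_completion_iff)
    have E': "UNIV - E' \<in> sets (completion (m x))"
      by (intro sets_completionI_sets) auto
    have "UNIV - E \<in> sets (completion (m x))"
      using completion.in_sets_AE[OF ae' E'] by simp
    then have "emeasure (completion (m x)) (UNIV - E) = emeasure (completion (m x)) (UNIV - E')"
      using ae' E' by (intro emeasure_eq_AE) auto
    then show ?case
      using elim(2) by (auto simp: indicator_def)
  qed
  then show ?thesis
    unfolding perimeter_def nn_integral_completion
    by (subst emeasure_jump_Times) (auto intro!: nn_integral_cong_AE)
qed

text \<open>
  The total variation counts jumps out of \<open>E\<close> and jumps into \<open>E\<close>; reversibility makes the two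
  contributions equal, which cancels the factor one half.
\<close>

lemma perimeter_eq_TV:
  assumes "E \<in> sets (completion \<nu>)"
  shows "perimeter m \<nu> E = TV m \<nu> (indicator E)"
proof -
  obtain E' where [measurable]: "E' \<in> sets borel" and ae: "AE x in \<nu>. x \<in> E \<longleftrightarrow> x \<in> E'"
    using Borel_set_representative[OF assms] .
  let ?J = "E' \<times> (UNIV - E')" and ?K = "(UNIV - E') \<times> E'"
  have [measurable]: "?J \<in> sets (borel \<Otimes>\<^sub>M borel)" "?K \<in> sets (borel \<Otimes>\<^sub>M borel)"
    by (auto intro!: pair_measureI)
  have "(\<integral>\<^sup>+p. ennreal \<bar>indicator E' (snd p) - indicator E' (fst p)\<bar> \<partial>jump)
      = (\<integral>\<^sup>+p. indicator ?J p + indicator ?K p \<partial>jump)"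
    by (intro nn_integral_cong) (auto simp: indicator_def)
  also have "\<dots> = emeasure jump ?J + emeasure jump ?K"
    by (subst nn_integral_add) auto
  also have "emeasure jump ?K = emeasure jump ?J"
    by (rule emeasure_jump_swap) auto
  also have "emeasure jump ?J = perimeter m \<nu> E"
    by (rule perimeter_Borel_representative[symmetric]) (use ae in auto)
  finally have "TV m \<nu> (indicator E') = (perimeter m \<nu> E + perimeter m \<nu> E) / 2"
    by (subst TV_Borel) auto
  also have "\<dots> = perimeter m \<nu> E"
    by (simp flip: mult_2 add: mult_divide_eq_ennreal mult.commute[of 2])
  also have "TV m \<nu> (indicator E') = TV m \<nu> (indicator E)"
    using ae by (intro TV_cong_AE) (auto simp: indicator_def)
  finally show ?thesis ..
qed

lemma perimeter_finite:
  assumes "E \<in> sets (completion \<nu>)"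
  shows "perimeter m \<nu> E < \<infinity>"
proof -
  obtain E' where "E' \<in> sets borel" "AE x in \<nu>. x \<in> E \<longleftrightarrow> x \<in> E'"
    using Borel_set_representative[OF assms] .
  then show ?thesis
    using perimeter_Borel_representative[of E' E] jump.emeasure_finite[of "E' \<times> (UNIV - E')"]
    by (simp add: less_top[symmetric])
qed

text \<open>
  A jump leaving \<open>E\<close> either leaves \<open>F\<close>, or starts in \<open>E - F\<close>, or ends in \<open>F - E\<close>. Since
  both marginals of \<open>jump\<close> are \<open>\<nu>\<close>, the last two events together have the measure of the symmetric
  difference.
\<close>

lemma perimeter_le_add_sym_diff:
  assumes E: "E \<in> sets (completion \<nu>)" and F: "F \<in> sets (completion \<nu>)"
  shows "perimeter m \<nu> E \<le> perimeter m \<nu> F + emeasure (completion \<nu>) (sym_diff E F)"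
proof -
  obtain E' where [measurable]: "E' \<in> sets borel" and aeE: "AE x in \<nu>. x \<in> E \<longleftrightarrow> x \<in> E'"
    using Borel_set_representative[OF E] .
  obtain F' where [measurable]: "F' \<in> sets borel" and aeF: "AE x in \<nu>. x \<in> F \<longleftrightarrow> x \<in> F'"
    using Borel_set_representative[OF F] .
  let ?D = "sym_diff E' F'"
  have "E' \<times> (UNIV - E') \<subseteq> F' \<times> (UNIV - F') \<union> ((E' - F') \<times> UNIV \<union> UNIV \<times> (F' - E'))"
    by auto
  then have "emeasure jump (E' \<times> (UNIV - E'))
      \<le> emeasure jump (F' \<times> (UNIV - F') \<union> ((E' - F') \<times> UNIV \<union> UNIV \<times> (F' - E')))"
    by (intro emeasure_mono) (auto intro!: sets.Un pair_measureI)
  also have "\<dots> \<le> emeasure jump (F' \<times> (UNIV - F')) + (emeasure jump ((E' - F') \<times> UNIV) + emeasure jump (UNIV \<times> (F' - E')))"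
    by (intro order_trans[OF emeasure_subadditive] add_left_mono emeasure_subadditive)
      (auto intro!: sets.Un pair_measureI)
  also have "emeasure jump ((E' - F') \<times> UNIV) + emeasure jump (UNIV \<times> (F' - E')) = emeasure \<nu> ?D"
    by (simp, rule plus_emeasure) auto
  also have "emeasure \<nu> ?D = emeasure (completion \<nu>) ?D"
    by simp
  also have "\<dots> = emeasure (completion \<nu>) (sym_diff E F)"
    using AE_completion[OF aeE] AE_completion[OF aeF] E F by (intro emeasure_eq_AE) auto
  finally show ?thesis
    using perimeter_Borel_representative[OF _ aeE] perimeter_Borel_representative[OF _ aeF] by simp
qed

section \<open>Minimality tested on sets\<close>

text \<open>
  The hypothesis, applied to the superlevel sets of a Borel representative of \<open>v\<close>, is integrated over
  the levels in \<open>(0, 1)\<close>, an interval of length 1.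
\<close>

lemma energy_ge_of_sets:
  assumes \<Omega>: "\<Omega> \<in> sets (completion \<nu>)"
    and test: "\<And>E. E \<in> sets (completion \<nu>) \<Longrightarrow>
      perimeter m \<nu> \<Omega> \<le> perimeter m \<nu> E + ennreal lam * emeasure (completion \<nu>) (sym_diff \<Omega> E)"
    and v: "v \<in> borel_measurable (completion \<nu>)"
  shows "perimeter m \<nu> \<Omega> \<le> energy m \<nu> (indicator \<Omega>) lam v"
proof -
  obtain w where w: "w \<in> borel_measurable \<nu>" and vw: "AE x in \<nu>. v x = w x"
    using completion_ex_borel_measurable_real[OF v] by auto
  then have [measurable]: "w \<in> borel_measurable borel"
    by simp
  obtain W where W [measurable]: "W \<in> sets borel" and \<Omega>W: "AE x in \<nu>. x \<in> \<Omega> \<longleftrightarrow> x \<in> W"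
    using Borel_set_representative[OF \<Omega>] .
  let ?L = "\<lambda>t. {x. t < w x}"
  let ?V = "\<lambda>t. \<integral>\<^sup>+p. ennreal \<bar>indicator {t<..} (w (snd p)) - indicator {t<..} (w (fst p))\<bar> \<partial>jump"
  let ?D = "\<lambda>t. \<integral>\<^sup>+x. ennreal \<bar>indicator {t<..} (w x) - indicator {t<..} (indicator W x)\<bar> \<partial>\<nu>"
  have L [measurable]: "?L t \<in> sets borel" for t
    by measurable
  have [measurable]: "?V \<in> borel_measurable lborel"
    by (rule jump.borel_measurable_superlevel_distance) auto
  have [measurable]: "?D \<in> borel_measurable lborel"
    by (rule borel_measurable_superlevel_distance) auto
  have level: "perimeter m \<nu> \<Omega> \<le> ?V t / 2 + ennreal lam * ?D t" if t: "t \<in> {0<..<1}" for t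
  proof -
    have Lc: "?L t \<in> sets (completion \<nu>)"
      by (intro sets_completionI_sets) simp
    have "perimeter m \<nu> (?L t) = ?V t / 2"
      by (subst perimeter_eq_TV[OF Lc], subst TV_Borel)
        (auto simp: indicator_def)
    moreover have "?D t = (\<integral>\<^sup>+x. ennreal \<bar>indicator (?L t) x - indicator W x\<bar> \<partial>\<nu>)"
      using t by (intro nn_integral_cong) (auto simp: indicator_def)
    moreover have "\<dots> = emeasure (completion \<nu>) (sym_diff W (?L t))"
      by (subst nn_integral_indicator_diff) auto
    moreover have "\<dots> = emeasure (completion \<nu>) (sym_diff \<Omega> (?L t))"
      using AE_completion[OF \<Omega>W]
      by (intro emeasure_eq_AE sets.Un sets.Diff Lc \<Omega> sets_completionI_sets) auto
    ultimately show ?thesis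
      using test[OF Lc] by simp
  qed
  have "perimeter m \<nu> \<Omega> = (\<integral>\<^sup>+t\<in>{0<..<1::real}. perimeter m \<nu> \<Omega> \<partial>lborel)"
    by (simp add: nn_integral_cmult)
  also have "\<dots> \<le> (\<integral>\<^sup>+t. ?V t * indicator {0<..<1} t / 2 + ennreal lam * (?D t * indicator {0<..<1} t) \<partial>lborel)"
    using level by (intro nn_integral_mono) (auto simp: indicator_def)
  also have "\<dots> = (\<integral>\<^sup>+t\<in>{0<..<1}. ?V t \<partial>lborel) / 2 + ennreal lam * (\<integral>\<^sup>+t\<in>{0<..<1}. ?D t \<partial>lborel)"
    by (simp add: nn_integral_add nn_integral_divide nn_integral_cmult)
  also have "\<dots> \<le> TV m \<nu> w + ennreal lam * (\<integral>\<^sup>+x. ennreal \<bar>w x - indicator W x\<bar> \<partial>\<nu>)"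
    unfolding TV_Borel[OF \<open>w \<in> borel_measurable borel\<close>]
    by (intro add_mono mult_left_mono divide_right_mono_ennreal
        jump.nn_integral_superlevel_distance_le nn_integral_superlevel_distance_le) auto
  also have "TV m \<nu> w = TV m \<nu> v"
    using vw by (intro TV_cong_AE) auto
  also have "(\<integral>\<^sup>+x. ennreal \<bar>w x - indicator W x\<bar> \<partial>\<nu>) = (\<integral>\<^sup>+x. ennreal \<bar>v x - indicator \<Omega> x\<bar> \<partial>\<nu>)"
  proof (intro nn_integral_cong_AE)
    show "AE x in \<nu>. ennreal \<bar>w x - indicator W x\<bar> = ennreal \<bar>v x - indicator \<Omega> x\<bar>"
      using vw \<Omega>W by eventually_elim (auto simp: indicator_def)
  qed
  finally show ?thesis
    by (simp add: energy_def nn_integral_completion)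
qed

lemma indicator_minimizer_iff:
  assumes \<Omega>: "\<Omega> \<in> sets (completion \<nu>)"
  shows "indicator \<Omega> \<in> minimizers m \<nu> (indicator \<Omega>) lam \<longleftrightarrow>
    (\<forall>E\<in>sets (completion \<nu>).
       perimeter m \<nu> \<Omega> \<le> perimeter m \<nu> E + ennreal lam * emeasure (completion \<nu>) (sym_diff \<Omega> E))"
proof -
  interpret c: finite_measure "completion \<nu>"
    by standard simp
  have energy: "energy m \<nu> (indicator \<Omega>) lam (indicator E)
      = perimeter m \<nu> E + ennreal lam * emeasure (completion \<nu>) (sym_diff \<Omega> E)"
    if "E \<in> sets (completion \<nu>)" for E
    using that \<Omega> by (simp add: energy_def perimeter_eq_TV nn_integral_indicator_diff del: emeasure_completion)
  have int: "integrable (completion \<nu>) (indicator E :: 'a \<Rightarrow> real)" if "E \<in> sets (completion \<nu>)" for E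
    using that c.emeasure_finite[of E]
    by (intro integrable_real_indicator) (auto simp: less_top[symmetric] simp del: emeasure_completion)
  have self: "energy m \<nu> (indicator \<Omega>) lam (indicator \<Omega>) = perimeter m \<nu> \<Omega>"
    using energy[OF \<Omega>] by simp
  show ?thesis
  proof
    assume "indicator \<Omega> \<in> minimizers m \<nu> (indicator \<Omega>) lam"
    then have "perimeter m \<nu> \<Omega> \<le> energy m \<nu> (indicator \<Omega>) lam (indicator E)"
      if "E \<in> sets (completion \<nu>)" for E
      using int[OF that] by (simp add: minimizers_def self)
    then show "\<forall>E\<in>sets (completion \<nu>).
       perimeter m \<nu> \<Omega> \<le> perimeter m \<nu> E + ennreal lam * emeasure (completion \<nu>) (sym_diff \<Omega> E)"
      using energy by metis
  next
    assume "\<forall>E\<in>sets (completion \<nu>).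
       perimeter m \<nu> \<Omega> \<le> perimeter m \<nu> E + ennreal lam * emeasure (completion \<nu>) (sym_diff \<Omega> E)"
    then show "indicator \<Omega> \<in> minimizers m \<nu> (indicator \<Omega>) lam"
      using int[OF \<Omega>] energy_ge_of_sets[OF \<Omega>, of lam] self
      by (auto simp: minimizers_def simp del: emeasure_completion)
  qed
qed

section \<open>The threshold as a supremum\<close>

lemma perimeter_le_iff_ratio_le:
  assumes \<Omega>: "\<Omega> \<in> sets (completion \<nu>)" and E: "E \<in> sets (completion \<nu>)" and lam: "0 \<le> lam"
    and pos: "0 < emeasure (completion \<nu>) (sym_diff \<Omega> E)"
  shows "perimeter m \<nu> \<Omega> \<le> perimeter m \<nu> E + ennreal lam * emeasure (completion \<nu>) (sym_diff \<Omega> E) \<longleftrightarrow>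
    (enn2real (perimeter m \<nu> \<Omega>) - enn2real (perimeter m \<nu> E)) / measure (completion \<nu>) (sym_diff \<Omega> E) \<le> lam"
proof -
  interpret c: finite_measure "completion \<nu>"
    by standard simp
  let ?D = "sym_diff \<Omega> E"
  have P: "perimeter m \<nu> A = ennreal (enn2real (perimeter m \<nu> A))" if "A \<in> sets (completion \<nu>)" for A
    using perimeter_finite[OF that] by simp
  have D: "emeasure (completion \<nu>) ?D = ennreal (measure (completion \<nu>) ?D)"
    by (rule c.emeasure_eq_measure)
  then have D_pos: "0 < measure (completion \<nu>) ?D"
    using pos by (simp add: ennreal_0 zero_less_measure_iff)
  have "perimeter m \<nu> \<Omega> \<le> perimeter m \<nu> E + ennreal lam * emeasure (completion \<nu>) ?D \<longleftrightarrow>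
      enn2real (perimeter m \<nu> \<Omega>) \<le> enn2real (perimeter m \<nu> E) + lam * measure (completion \<nu>) ?D"
    by (subst P[OF \<Omega>], subst P[OF E], subst D)
      (use lam in \<open>simp flip: ennreal_mult ennreal_plus\<close>)
  also have "\<dots> \<longleftrightarrow> (enn2real (perimeter m \<nu> \<Omega>) - enn2real (perimeter m \<nu> E)) / measure (completion \<nu>) ?D \<le> lam"
    using D_pos by (auto simp: field_simps)
  finally show ?thesis .
qed

end

text \<open>
  The supremum itself is a positive upper bound unless it is 0; approaching it by \<open>Sup R + e\<close> treats
  both cases at once.
\<close>

lemma Inf_pos_upper_bounds:
  fixes R :: "real set"
  assumes "r \<in> R" "0 \<le> r" "bdd_above R"
  shows "Inf {lam. 0 < lam \<and> (\<forall>r\<in>R. r \<le> lam)} = Sup R"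
proof (rule antisym)
  have S: "0 \<le> Sup R"
    using assms cSup_upper order_trans by blast
  have bdd: "bdd_below {lam. 0 < lam \<and> (\<forall>r\<in>R. r \<le> lam)}"
    by (rule bdd_belowI[of _ 0]) auto
  show "Inf {lam. 0 < lam \<and> (\<forall>r\<in>R. r \<le> lam)} \<le> Sup R"
  proof (rule field_le_epsilon)
    fix e :: real assume "0 < e"
    then show "Inf {lam. 0 < lam \<and> (\<forall>r\<in>R. r \<le> lam)} \<le> Sup R + e"
      using S cSup_upper[OF _ assms(3)] by (intro cInf_lower bdd) (auto intro: add_nonneg_pos add_increasing2 order.strict_implies_order)
  qed
  have "Sup R + 1 \<in> {lam. 0 < lam \<and> (\<forall>r\<in>R. r \<le> lam)}"
    using S cSup_upper[OF _ assms(3)] by (auto intro: add_nonneg_pos add_increasing2)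
  then show "Sup R \<le> Inf {lam. 0 < lam \<and> (\<forall>r\<in>R. r \<le> lam)}"
    using assms(1) by (intro cInf_greatest cSup_least) auto
qed

theorem proposition3p32:
  fixes m :: "'a::polish_space \<Rightarrow> 'a measure" and \<nu> :: "'a measure" and \<Omega> :: "'a set"
  assumes "random_walk m"
    and "finite_radon_measure \<nu>"
    and "emeasure \<nu> UNIV \<noteq> 0"
    and "reversible m \<nu>"
    and "ergodic m \<nu>"
    and "\<Omega> \<in> sets (completion \<nu>)"
    and "0 < emeasure (completion \<nu>) \<Omega>"
    and "emeasure (completion \<nu>) \<Omega> < emeasure \<nu> UNIV"
  shows "ereal (threshold m \<nu> \<Omega>) =
    Sup {ereal ((enn2real (perimeter m \<nu> \<Omega>) - enn2real (perimeter m \<nu> E)) /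
                measure (completion \<nu>) (sym_diff \<Omega> E)) | E.
         E \<in> sets (completion \<nu>) \<and> 0 < emeasure (completion \<nu>) (sym_diff \<Omega> E)}"
proof -
  interpret reversible_walk m \<nu>
    by standard fact+
  interpret c: finite_measure "completion \<nu>"
    by standard simp
  note \<Omega> = \<open>\<Omega> \<in> sets (completion \<nu>)\<close>
  define T where "T = {E \<in> sets (completion \<nu>). 0 < emeasure (completion \<nu>) (sym_diff \<Omega> E)}"
  define ratio where "ratio E = (enn2real (perimeter m \<nu> \<Omega>) - enn2real (perimeter m \<nu> E)) /
    measure (completion \<nu>) (sym_diff \<Omega> E)" for E
  have "perimeter m \<nu> \<Omega> \<le> perimeter m \<nu> E + ennreal lam * emeasure (completion \<nu>) (sym_diff \<Omega> E)"
    if "E \<in> sets (completion \<nu>)" "E \<notin> T" for E lam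
    using perimeter_le_add_sym_diff[OF \<Omega> that(1)] that by (simp add: T_def del: emeasure_completion)
  moreover have "perimeter m \<nu> \<Omega> \<le> perimeter m \<nu> E + ennreal lam * emeasure (completion \<nu>) (sym_diff \<Omega> E) \<longleftrightarrow>
      ratio E \<le> lam" if "0 < lam" "E \<in> T" for E lam
    unfolding ratio_def using that by (intro perimeter_le_iff_ratio_le[OF \<Omega>]) (auto simp: T_def)
  moreover have "T \<subseteq> sets (completion \<nu>)"
    by (auto simp: T_def)
  ultimately have "indicator \<Omega> \<in> minimizers m \<nu> (indicator \<Omega>) lam \<longleftrightarrow> (\<forall>r\<in>ratio ` T. r \<le> lam)"
    if "0 < lam" for lam
    unfolding indicator_minimizer_iff[OF \<Omega>] ball_simps using that by blast
  then have threshold: "threshold m \<nu> \<Omega> = Inf {lam. 0 < lam \<and> (\<forall>r\<in>ratio ` T. r \<le> lam)}"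
    unfolding threshold_def by (intro arg_cong[where f = Inf]) blast

  \<comment> \<open>The whole space competes, as its complement of \<open>\<Omega>\<close> is not null, and it gives a nonnegative ratio.\<close>
  have "emeasure (completion \<nu>) (UNIV - \<Omega>) = emeasure \<nu> UNIV - emeasure (completion \<nu>) \<Omega>"
    using emeasure_compl[OF \<Omega>] c.emeasure_finite[of \<Omega>] by (simp del: emeasure_completion) simp
  then have "0 < emeasure (completion \<nu>) (sym_diff \<Omega> UNIV)"
    using assms(8) by (simp add: diff_gr0_ennreal Diff_eq_empty_iff[THEN iffD2] del: emeasure_completion)
  moreover have "UNIV \<in> sets (completion \<nu>)"
    by (metis sets.top space_completion space_invariant)
  ultimately have UNIV: "UNIV \<in> T"
    by (simp add: T_def)
  have "perimeter m \<nu> UNIV = 0"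
    by (simp add: perimeter_def del: emeasure_completion)
  then have nonneg: "0 \<le> ratio UNIV"
    by (simp add: ratio_def)
  have ratio_le: "ratio E \<le> 1" if "E \<in> T" for E
    using perimeter_le_iff_ratio_le[OF \<Omega>, of E 1] perimeter_le_add_sym_diff[OF \<Omega>, of E] that
    by (simp add: T_def ratio_def del: emeasure_completion)
  then have bdd: "bdd_above (ratio ` T)"
    by (intro bdd_aboveI2)
  have "ereal (threshold m \<nu> \<Omega>) = ereal (Sup (ratio ` T))"
    unfolding threshold using Inf_pos_upper_bounds[OF imageI[OF UNIV] nonneg bdd] by simp
  also have "\<dots> = (SUP E\<in>T. ereal (ratio E))"
  proof (rule ereal_SUP)
    have "ereal (ratio UNIV) \<le> (SUP E\<in>T. ereal (ratio E))"
      by (rule SUP_upper[OF UNIV])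
    moreover have "(SUP E\<in>T. ereal (ratio E)) \<le> ereal 1"
      using ratio_le by (intro SUP_least) simp
    ultimately show "\<bar>SUP E\<in>T. ereal (ratio E)\<bar> \<noteq> \<infinity>"
      by auto
  qed
  also have "(\<lambda>E. ereal (ratio E)) ` T = {ereal (ratio E) | E.
      E \<in> sets (completion \<nu>) \<and> 0 < emeasure (completion \<nu>) (sym_diff \<Omega> E)}"
    by (auto simp: T_def)
  finally show ?thesis
    by (simp add: ratio_def)
qed

end
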